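(* Let $p\ge1$ and consider the complex-valued stationary autoregressive model $\mathrm{AR}(p;\mathbb{C})$ parameterized by $\xi\in\Theta_1$, with Jeffreys prior $\pi_J$. Let $\phi(\xi)=\prod_{i=1}^p\prod_{j=1}^p(1-\xi^i\bar\xi^j)$ and, for $\kappa\in\mathbb{R}$, $\pi^{(\kappa)}:=\phi^{-\kappa+1}\pi_J$. Then for every $\kappa\in\mathbb{R}$ the prior $\pi^{(\kappa)}$ is an $\alpha$-parallel prior on $\Theta_1$ with $\alpha=(1-\kappa)/2$.
   Context: Conventions: Einstein summation is used; $\beta,\gamma,\delta,\epsilon$ run over $\{1,\dots,p,\bar1,\dots,\bar p\}$. For $\xi^i=x^i+\sqrt{-1}\,y^i$, $\partial_i=\frac12(\partial_{x^i}-\sqrt{-1}\,\partial_{y^i})$ and $\partial_{\bar i}=\frac12(\partial_{x^i}+\sqrt{-1}\,\partial_{y^i})$. $\Theta_1=\{(\xi^1,\dots,\xi^p)\in\mathbb{C}^p:\ |\xi^i|<1\text{ for all }i,\ \xi^i\ne\xi^j\text{ for }i\ne j\}$, and the power spectral density at $\xi\in\Theta_1$ is $S(\omega)=S(\omega\mid\xi)=\frac{1}{2\pi|\prod_{i=1}^p(1-\xi^ie^{-\sqrt{-1}\omega})|^2}$, $\omega\in[-\pi,\pi]$. Put $g_{\beta\gamma}=\frac1{2\pi}\int_{-\pi}^{\pi}(\partial_\beta\log S)(\partial_\gamma\log S)\,d\omega$, with inverse matrix $[g^{\beta\gamma}]$ (explicitly $g_{ij}=g_{\bar i\bar j}=0$,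 $g_{i\bar j}=g_{\bar ji}=1/(1-\xi^i\bar\xi^j)$); $T_{\beta\gamma\delta}=\frac1\pi\int_{-\pi}^{\pi}(\partial_\beta\log S)(\partial_\gamma\log S)(\partial_\delta\log S)\,d\omega$; $\Gamma^{(m)}_{\beta\gamma\delta}=\frac1{2\pi}\int_{-\pi}^{\pi}\frac{\partial_\beta\partial_\gamma S}{S}(\partial_\delta\log S)\,d\omega$. The Jeffreys prior is $\pi_J(\xi)=\det[g_{i\bar j}]=\prod_{1\le i<j\le p}|\xi^i-\xi^j|^2\big/\prod_{i,j=1}^p(1-\xi^i\bar\xi^j)$. For $\alpha\in\mathbb{R}$ the coefficients of the $\alpha$-connection are $\Gamma^{(\alpha)}_{\beta\gamma\delta}=\Gamma^{(m)}_{\beta\gamma\delta}-\frac{1+\alpha}{2}T_{\beta\gamma\delta}$ and $\Gamma^{(\alpha)\,\delta}_{\beta\gamma}=\Gamma^{(\alpha)}_{\beta\gamma\epsilon}g^{\epsilon\delta}$. A non-negative function $\rho$ on the parameter space is an $\alpha$-parallel prior if $\partial_\beta\rho=\Gamma^{(\alpha)\,\gamma}_{\beta\gamma}\,\rho$ (summed over $\gamma$) for all $\beta\in\{1,\dots,p,\bar1,\dots,\bar p\}$. *)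

theory Defs
  imports "HOL-Analysis.Analysis"
begin

text \<open>
  A point \<open>\<xi>\<close> of \<open>p\<close>-dimensional complex space is \<open>\<xi> :: complex^'p\<close> with \<open>p = CARD('p)\<close>,
  and \<open>\<xi> $ i\<close> is the coordinate written with an upper index \<open>i\<close>.
  Tensor indices range over the sum type \<open>'p + 'p\<close>: \<open>Inl i\<close> is the holomorphic
  index \<open>i\<close> and \<open>Inr i\<close> is the conjugate index \<open>i\<close>-bar.
\<close>

definition Theta1 :: "(complex^'p) set" where
  "Theta1 = {\<xi>. (\<forall>i. cmod (\<xi> $ i) < 1) \<and> (\<forall>i j. i \<noteq> j \<longrightarrow> \<xi> $ i \<noteq> \<xi> $ j)}"

definition partial_x :: "'p \<Rightarrow> (complex^'p \<Rightarrow> complex) \<Rightarrow> complex^'p \<Rightarrow> complex" where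
  "partial_x i f \<xi> = vector_derivative (\<lambda>t::real. f (\<xi> + axis i (complex_of_real t))) (at 0)"

definition partial_y :: "'p \<Rightarrow> (complex^'p \<Rightarrow> complex) \<Rightarrow> complex^'p \<Rightarrow> complex" where
  "partial_y i f \<xi> = vector_derivative (\<lambda>t::real. f (\<xi> + axis i (\<i> * complex_of_real t))) (at 0)"

fun wirtinger :: "'p + 'p \<Rightarrow> (complex^'p \<Rightarrow> complex) \<Rightarrow> complex^'p \<Rightarrow> complex" where
  "wirtinger (Inl i) f \<xi> = (partial_x i f \<xi> - \<i> * partial_y i f \<xi>) / 2"
| "wirtinger (Inr i) f \<xi> = (partial_x i f \<xi> + \<i> * partial_y i f \<xi>) / 2"

definition spectral_density :: "real \<Rightarrow> complex^'p \<Rightarrow> real" where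
  "spectral_density \<omega> \<xi> =
     1 / (2 * pi * (cmod (\<Prod>i\<in>UNIV. 1 - \<xi> $ i * exp (- (\<i> * complex_of_real \<omega>))))\<^sup>2)"

definition dlogS :: "'p + 'p \<Rightarrow> real \<Rightarrow> complex^'p \<Rightarrow> complex" where
  "dlogS \<beta> \<omega> \<xi> = wirtinger \<beta> (\<lambda>\<zeta>. complex_of_real (ln (spectral_density \<omega> \<zeta>))) \<xi>"

definition metric :: "complex^'p \<Rightarrow> complex^('p + 'p)^('p + 'p)" where
  "metric \<xi> = (\<chi> \<beta> \<gamma>. 1 / (2 * of_real pi) *
     integral {-pi..pi} (\<lambda>\<omega>. dlogS \<beta> \<omega> \<xi> * dlogS \<gamma> \<omega> \<xi>))"

definition inv_metric :: "complex^'p \<Rightarrow> complex^('p + 'p)^('p + 'p)" where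
  "inv_metric \<xi> = matrix_inv (metric \<xi>)"

definition skewness_T :: "complex^'p \<Rightarrow> 'p + 'p \<Rightarrow> 'p + 'p \<Rightarrow> 'p + 'p \<Rightarrow> complex" where
  "skewness_T \<xi> \<beta> \<gamma> \<delta> = 1 / of_real pi *
     integral {-pi..pi} (\<lambda>\<omega>. dlogS \<beta> \<omega> \<xi> * dlogS \<gamma> \<omega> \<xi> * dlogS \<delta> \<omega> \<xi>)"

definition Gamma_m :: "complex^'p \<Rightarrow> 'p + 'p \<Rightarrow> 'p + 'p \<Rightarrow> 'p + 'p \<Rightarrow> complex" where
  "Gamma_m \<xi> \<beta> \<gamma> \<delta> = 1 / (2 * of_real pi) *
     integral {-pi..pi} (\<lambda>\<omega>.
       wirtinger \<beta> (wirtinger \<gamma> (\<lambda>\<zeta>. complex_of_real (spectral_density \<omega> \<zeta>))) \<xi>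
         / complex_of_real (spectral_density \<omega> \<xi>) * dlogS \<delta> \<omega> \<xi>)"

definition Gamma_alpha ::
    "real \<Rightarrow> complex^'p \<Rightarrow> 'p + 'p \<Rightarrow> 'p + 'p \<Rightarrow> 'p + 'p \<Rightarrow> complex" where
  "Gamma_alpha \<alpha> \<xi> \<beta> \<gamma> \<delta> =
     Gamma_m \<xi> \<beta> \<gamma> \<delta> - complex_of_real ((1 + \<alpha>) / 2) * skewness_T \<xi> \<beta> \<gamma> \<delta>"

text \<open>The last index argument \<open>\<delta>\<close> of \<open>Gamma_alpha_up\<close> is the raised (upper) one.\<close>

definition Gamma_alpha_up ::
    "real \<Rightarrow> complex^'p \<Rightarrow> 'p + 'p \<Rightarrow> 'p + 'p \<Rightarrow> 'p + 'p \<Rightarrow> complex" where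
  "Gamma_alpha_up \<alpha> \<xi> \<beta> \<gamma> \<delta> =
     (\<Sum>\<epsilon>\<in>UNIV. Gamma_alpha \<alpha> \<xi> \<beta> \<gamma> \<epsilon> * inv_metric \<xi> $ \<epsilon> $ \<delta>)"

text \<open>
  Priors are taken complex-valued; that the values are real and non-negative is part of
  the definition, as is (real) differentiability, so that \<open>wirtinger \<beta> \<rho> \<xi>\<close>
  is never the arbitrary value of a non-existing derivative.
\<close>

definition alpha_parallel_prior ::
    "real \<Rightarrow> (complex^'p) set \<Rightarrow> (complex^'p \<Rightarrow> complex) \<Rightarrow> bool" where
  "alpha_parallel_prior \<alpha> \<Theta> \<rho> \<longleftrightarrow>
     (\<forall>\<xi>\<in>\<Theta>. \<rho> \<xi> \<in> \<real>\<^sub>\<ge>\<^sub>0 \<and> \<rho> differentiable (at \<xi>) \<and>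
        (\<forall>\<beta>. wirtinger \<beta> \<rho> \<xi> = (\<Sum>\<gamma>\<in>UNIV. Gamma_alpha_up \<alpha> \<xi> \<beta> \<gamma> \<gamma>) * \<rho> \<xi>))"

definition jeffreys_prior :: "complex^'p \<Rightarrow> complex" where
  "jeffreys_prior \<xi> = det ((\<chi> i j. metric \<xi> $ Inl i $ Inr j) :: complex^'p^'p)"

definition phi :: "complex^'p \<Rightarrow> complex" where
  "phi \<xi> = (\<Prod>i\<in>UNIV. \<Prod>j\<in>UNIV. 1 - \<xi> $ i * cnj (\<xi> $ j))"

text \<open>
  On \<open>Theta1\<close> the value \<open>phi \<xi>\<close> is a positive real (the factors \<open>(i, j)\<close> and \<open>(j, i)\<close>
  are conjugate), so the principal-branch power below is the ordinary real power.
\<close>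

definition kappa_prior :: "real \<Rightarrow> complex^'p \<Rightarrow> complex" where
  "kappa_prior \<kappa> \<xi> = phi \<xi> powr complex_of_real (- \<kappa> + 1) * jeffreys_prior \<xi>"

end

theory Submission
  imports Defs "HOL-Complex_Analysis.Cauchy_Integral_Formula"
begin

text \<open>
  With \<open>z = exp (-\<i> \<omega>)\<close> the scores are \<open>u\<^sub>i = z / (1 - \<xi>\<^sub>i z)\<close> and their conjugates, and
  differentiating \<open>S\<close> twice gives \<open>\<partial>\<^sub>\<beta> \<partial>\<^sub>\<gamma> S = (1 + \<delta>\<^sub>\<beta>\<^sub>\<gamma>) u\<^sub>\<beta> u\<^sub>\<gamma> S\<close>. Hence the \<open>\<alpha>\<close>-connection is
  \<open>(\<delta>\<^sub>\<beta>\<^sub>\<gamma> - \<alpha>)\<close> times the mean of \<open>u\<^sub>\<beta> u\<^sub>\<gamma> u\<^sub>\<delta>\<close>. Cauchy's formula evaluates these means in terms of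
  the matrix \<open>K\<^sub>i\<^sub>j = 1 / (1 - \<xi>\<^sub>i cnj \<xi>\<^sub>j)\<close>. In the contracted connection the diagonal part is, by Jacobi's
  formula, the logarithmic derivative of \<open>det K\<close>, and the part with factor \<open>\<alpha>\<close> collapses through
  \<open>K\<^sup>-\<^sup>1 K = 1\<close> to \<open>2 \<alpha>\<close> times that of \<open>phi\<close>. No explicit Cauchy determinant is needed: \<open>K\<close> is a
  Gram matrix of geometric sequences, so it is positive definite when the \<open>\<xi>\<^sub>i\<close> are distinct.
\<close>

subsection \<open>Wirtinger calculus\<close>

text \<open>Every real-linear map from complex p-space to the complex numbers has exactly one such
  form; for a derivative the coefficients are the Wirtinger derivatives.\<close>

definition wirtinger_form :: "('p + 'p \<Rightarrow> complex) \<Rightarrow> complex^'p \<Rightarrow> complex" where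
  "wirtinger_form a v = (\<Sum>i\<in>UNIV. a (Inl i) * v $ i + a (Inr i) * cnj (v $ i))"

text \<open>\<open>partial_x\<close> and \<open>partial_y\<close> rest on
  \<open>vector_derivative\<close>, an arbitrary value where no derivative exists. The rules of
  calculus are therefore proved for this predicate, which carries the full real derivative with all
  its coefficients.\<close>

definition has_wirtinger ::
    "(complex^'p \<Rightarrow> complex) \<Rightarrow> ('p + 'p \<Rightarrow> complex) \<Rightarrow> complex^'p \<Rightarrow> bool" where
  "has_wirtinger f a \<xi> \<longleftrightarrow> (f has_derivative wirtinger_form a) (at \<xi>)"

lemma wirtinger_form_axis:
  "wirtinger_form a (axis i c) = a (Inl i) * c + a (Inr i) * cnj c"
proof -
  have "wirtinger_form a (axis i c) =
      (\<Sum>j\<in>UNIV. if j = i then a (Inl i) * c + a (Inr i) * cnj c else 0)"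
    unfolding wirtinger_form_def by (rule sum.cong) (auto simp: axis_def)
  then show ?thesis by simp
qed

lemma wirtinger_form_add:
  "wirtinger_form (\<lambda>\<beta>. a \<beta> + b \<beta>) v = wirtinger_form a v + wirtinger_form b v"
  by (simp add: wirtinger_form_def algebra_simps sum.distrib)

lemma wirtinger_form_scale:
  "wirtinger_form (\<lambda>\<beta>. c * a \<beta>) v = c * wirtinger_form a v"
  by (simp add: wirtinger_form_def algebra_simps sum_distrib_left)

text \<open>Restricting the derivative to the lines in directions \<open>axis i 1\<close> and
  \<open>axis i \<i>\<close> gives the sum of the two coefficients and \<i> times their difference;
  the Wirtinger combinations solve for each coefficient.\<close>

lemma has_wirtinger_imp_wirtinger:
  assumes "has_wirtinger f a \<xi>"
  shows "wirtinger \<beta> f \<xi> = a \<beta>"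
proof -
  have D: "((\<lambda>t::real. f (\<xi> + t *\<^sub>R v)) has_vector_derivative wirtinger_form a v) (at 0)" for v
  proof -
    have inner: "((\<lambda>t::real. \<xi> + t *\<^sub>R v) has_derivative (\<lambda>t. t *\<^sub>R v)) (at 0)"
      by (auto intro!: derivative_eq_intros)
    have outer: "(f has_derivative wirtinger_form a) (at (\<xi> + (0::real) *\<^sub>R v))"
      using assms by (simp add: has_wirtinger_def)
    have lin: "linear (wirtinger_form a)"
      using assms unfolding has_wirtinger_def by (rule has_derivative_linear)
    from has_derivative_compose[OF inner outer] show ?thesis
      unfolding has_vector_derivative_def by (simp add: linear_scale[OF lin])
  qed
  have 1: "partial_x i f \<xi> = a (Inl i) + a (Inr i)" for i
  proof -
    have *: "axis i (complex_of_real t) = t *\<^sub>R axis i 1" for t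
      by (auto simp: vec_eq_iff axis_def complex_eq_iff)
    show ?thesis
      using vector_derivative_at[OF D[of "axis i 1"]]
      by (simp add: partial_x_def * wirtinger_form_axis)
  qed
  have 2: "partial_y i f \<xi> = \<i> * a (Inl i) - \<i> * a (Inr i)" for i
  proof -
    have *: "axis i (\<i> * complex_of_real t) = t *\<^sub>R axis i \<i>" for t
      by (auto simp: vec_eq_iff axis_def complex_eq_iff)
    show ?thesis
      using vector_derivative_at[OF D[of "axis i \<i>"]]
      by (simp add: partial_y_def * wirtinger_form_axis)
  qed
  show ?thesis
    by (cases \<beta>) (simp_all add: 1 2 algebra_simps)
qed

text \<open>Closed forms hold only on an open set such as \<open>polydisc\<close>; this lets them
  replace a function under a derivative. The filter \<open>nhds\<close>, unlike \<open>at\<close>,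
  also controls the value at the point.\<close>

lemma has_wirtinger_cong:
  assumes "has_wirtinger f a \<xi>" "eventually (\<lambda>\<zeta>. f \<zeta> = g \<zeta>) (nhds \<xi>)"
  shows "has_wirtinger g a \<xi>"
proof -
  have "eventually (\<lambda>\<zeta>. f \<zeta> = g \<zeta>) (at \<xi>)"
    using assms(2) by (auto simp: eventually_at_filter elim: eventually_mono)
  moreover have "f \<xi> = g \<xi>" using assms(2) by (rule eventually_nhds_x_imp_x)
  ultimately show ?thesis
    using assms(1) unfolding has_wirtinger_def
    by (auto intro: has_derivative_transform_eventually)
qed

lemma has_wirtinger_eqI:
  assumes "has_wirtinger f a \<xi>" "\<And>\<zeta>. g \<zeta> = f \<zeta>" "\<And>\<beta>. b \<beta> = a \<beta>"
  shows "has_wirtinger g b \<xi>"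
proof -
  have "g = f" "b = a" using assms(2,3) by auto
  then show ?thesis using assms(1) by simp
qed

lemma has_wirtinger_const:
  fixes \<xi> :: "complex^'p"
  shows "has_wirtinger (\<lambda>\<zeta>. c) (\<lambda>\<beta>. 0) \<xi>"
proof -
  have "wirtinger_form (\<lambda>\<beta>. 0) = (\<lambda>v :: complex^'p. 0)"
    by (auto simp: wirtinger_form_def fun_eq_iff)
  then show ?thesis by (simp add: has_wirtinger_def has_derivative_const)
qed

lemma has_wirtinger_coord: "has_wirtinger (\<lambda>\<zeta>. \<zeta> $ i) (\<lambda>\<beta>. if \<beta> = Inl i then 1 else 0) \<xi>"
proof -
  have "wirtinger_form (\<lambda>\<beta>. if \<beta> = Inl i then 1 else 0) = (\<lambda>v. v $ i)"
    by (auto simp: wirtinger_form_def fun_eq_iff if_distrib if_distribR cong: if_cong)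
  then show ?thesis
    unfolding has_wirtinger_def
    by (simp add: bounded_linear_imp_has_derivative bounded_linear_vec_nth)
qed

lemma has_wirtinger_cnj_coord:
  "has_wirtinger (\<lambda>\<zeta>. cnj (\<zeta> $ i)) (\<lambda>\<beta>. if \<beta> = Inr i then 1 else 0) \<xi>"
proof -
  have "wirtinger_form (\<lambda>\<beta>. if \<beta> = Inr i then 1 else 0) = (\<lambda>v. cnj (v $ i))"
    by (auto simp: wirtinger_form_def fun_eq_iff if_distrib if_distribR cong: if_cong)
  then show ?thesis
    unfolding has_wirtinger_def
    by (simp add: bounded_linear_imp_has_derivative bounded_linear_vec_nth
        bounded_linear_compose[OF bounded_linear_cnj])
qed

lemma has_wirtinger_add:
  assumes "has_wirtinger f a \<xi>" "has_wirtinger g b \<xi>"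
  shows "has_wirtinger (\<lambda>\<zeta>. f \<zeta> + g \<zeta>) (\<lambda>\<beta>. a \<beta> + b \<beta>) \<xi>"
proof -
  have "wirtinger_form (\<lambda>\<beta>. a \<beta> + b \<beta>) = (\<lambda>v. wirtinger_form a v + wirtinger_form b v)"
    by (simp add: fun_eq_iff wirtinger_form_add)
  then show ?thesis
    using assms unfolding has_wirtinger_def by (simp add: has_derivative_add)
qed

lemma has_wirtinger_mult:
  assumes "has_wirtinger f a \<xi>" "has_wirtinger g b \<xi>"
  shows "has_wirtinger (\<lambda>\<zeta>. f \<zeta> * g \<zeta>) (\<lambda>\<beta>. f \<xi> * b \<beta> + g \<xi> * a \<beta>) \<xi>"
proof -
  have "wirtinger_form (\<lambda>\<beta>. f \<xi> * b \<beta> + g \<xi> * a \<beta>) =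
      (\<lambda>v. f \<xi> * wirtinger_form b v + wirtinger_form a v * g \<xi>)"
    by (simp add: fun_eq_iff wirtinger_form_add wirtinger_form_scale)
  then show ?thesis
    using assms unfolding has_wirtinger_def by (simp add: has_derivative_mult)
qed

lemma has_wirtinger_cmult:
  assumes "has_wirtinger f a \<xi>"
  shows "has_wirtinger (\<lambda>\<zeta>. c * f \<zeta>) (\<lambda>\<beta>. c * a \<beta>) \<xi>"
  using has_wirtinger_mult[OF has_wirtinger_const assms, of c] by simp

text \<open>The outer function is complex differentiable, so its derivative acts as multiplication
  by \<open>h'\<close> and does not mix the two kinds of coefficients.\<close>

lemma has_wirtinger_compose:
  assumes "has_wirtinger f a \<xi>" "(h has_field_derivative h') (at (f \<xi>))"
  shows "has_wirtinger (\<lambda>\<zeta>. h (f \<zeta>)) (\<lambda>\<beta>. h' * a \<beta>) \<xi>"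
proof -
  have "wirtinger_form (\<lambda>\<beta>. h' * a \<beta>) = (\<lambda>v. h' * wirtinger_form a v)"
    by (simp add: fun_eq_iff wirtinger_form_scale)
  then show ?thesis
    using has_derivative_compose[OF assms(1)[unfolded has_wirtinger_def]
        assms(2)[unfolded has_field_derivative_def]]
    by (simp add: has_wirtinger_def)
qed

lemma has_wirtinger_sum:
  assumes "\<And>i. i \<in> I \<Longrightarrow> has_wirtinger (f i) (a i) \<xi>"
  shows "has_wirtinger (\<lambda>\<zeta>. \<Sum>i\<in>I. f i \<zeta>) (\<lambda>\<beta>. \<Sum>i\<in>I. a i \<beta>) \<xi>"
  using assms
  by (induction I rule: infinite_finite_induct)
    (simp_all add: has_wirtinger_const has_wirtinger_add)

lemma has_wirtinger_prod:
  assumes "finite I" "\<And>i. i \<in> I \<Longrightarrow> has_wirtinger (f i) (a i) \<xi>"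
  shows "has_wirtinger (\<lambda>\<zeta>. \<Prod>i\<in>I. f i \<zeta>) (\<lambda>\<beta>. \<Sum>i\<in>I. a i \<beta> * (\<Prod>j\<in>I - {i}. f j \<xi>)) \<xi>"
  using assms
proof (induction I rule: finite_induct)
  case empty
  then show ?case by (simp add: has_wirtinger_const)
next
  case (insert k I)
  have "(\<lambda>\<beta>. \<Sum>i\<in>insert k I. a i \<beta> * (\<Prod>j\<in>insert k I - {i}. f j \<xi>)) =
      (\<lambda>\<beta>. f k \<xi> * (\<Sum>i\<in>I. a i \<beta> * (\<Prod>j\<in>I - {i}. f j \<xi>)) + (\<Prod>i\<in>I. f i \<xi>) * a k \<beta>)"
  proof
    fix \<beta>
    have "(\<Sum>i\<in>I. a i \<beta> * (\<Prod>j\<in>insert k I - {i}. f j \<xi>)) =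
        (\<Sum>i\<in>I. f k \<xi> * (a i \<beta> * (\<Prod>j\<in>I - {i}. f j \<xi>)))"
    proof (rule sum.cong)
      fix i assume "i \<in> I"
      then have "insert k I - {i} = insert k (I - {i})" "k \<notin> I - {i}" "finite (I - {i})"
        using insert.hyps by auto
      then show "a i \<beta> * (\<Prod>j\<in>insert k I - {i}. f j \<xi>) =
          f k \<xi> * (a i \<beta> * (\<Prod>j\<in>I - {i}. f j \<xi>))" by simp
    qed simp
    moreover have "insert k I - {k} = I" using insert.hyps by auto
    ultimately show "(\<Sum>i\<in>insert k I. a i \<beta> * (\<Prod>j\<in>insert k I - {i}. f j \<xi>)) =
      f k \<xi> * (\<Sum>i\<in>I. a i \<beta> * (\<Prod>j\<in>I - {i}. f j \<xi>)) + (\<Prod>i\<in>I. f i \<xi>) * a k \<beta>"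
      using insert.hyps by (simp add: sum_distrib_left mult.commute)
  qed
  moreover have "has_wirtinger (\<lambda>\<zeta>. f k \<zeta> * (\<Prod>i\<in>I. f i \<zeta>))
     (\<lambda>\<beta>. f k \<xi> * (\<Sum>i\<in>I. a i \<beta> * (\<Prod>j\<in>I - {i}. f j \<xi>)) + (\<Prod>i\<in>I. f i \<xi>) * a k \<beta>) \<xi>"
    by (rule has_wirtinger_mult) (use insert in auto)
  ultimately show ?case using insert.hyps by simp
qed

text \<open>When each coefficient is the value times a logarithmic derivative, the missing factor is
  restored in every term of the product rule and the logarithmic derivatives add up.\<close>

lemma has_wirtinger_prod_log:
  assumes "finite I" "\<And>i. i \<in> I \<Longrightarrow> has_wirtinger (f i) (\<lambda>\<beta>. f i \<xi> * a i \<beta>) \<xi>"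
  shows "has_wirtinger (\<lambda>\<zeta>. \<Prod>i\<in>I. f i \<zeta>) (\<lambda>\<beta>. (\<Prod>i\<in>I. f i \<xi>) * (\<Sum>i\<in>I. a i \<beta>)) \<xi>"
proof -
  have "(\<Sum>i\<in>I. f i \<xi> * a i \<beta> * (\<Prod>j\<in>I - {i}. f j \<xi>)) =
      (\<Prod>i\<in>I. f i \<xi>) * (\<Sum>i\<in>I. a i \<beta>)" for \<beta>
    unfolding sum_distrib_left
    by (rule sum.cong) (auto simp: prod.remove[OF \<open>finite I\<close>])
  then show ?thesis
    using has_wirtinger_prod[of I f "\<lambda>i \<beta>. f i \<xi> * a i \<beta>" \<xi>, OF assms] by simp
qed

lemma has_wirtinger_imp_differentiable:
  "has_wirtinger f a \<xi> \<Longrightarrow> f differentiable (at \<xi>)"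
  unfolding has_wirtinger_def differentiable_def by blast

text \<open>Jacobi's formula, with the inverse matrix \<open>B\<close> in place of the adjugate.\<close>

lemma has_wirtinger_det:
  fixes A :: "complex^'p \<Rightarrow> complex^'n^'n"
  assumes "\<And>i j. has_wirtinger (\<lambda>\<zeta>. A \<zeta> $ i $ j) (\<lambda>\<beta>. a \<beta> i j) \<xi>" and "A \<xi> ** B = mat 1"
  shows "has_wirtinger (\<lambda>\<zeta>. det (A \<zeta>))
    (\<lambda>\<beta>. det (A \<xi>) * (\<Sum>i\<in>UNIV. \<Sum>j\<in>UNIV. a \<beta> i j * B $ j $ i)) \<xi>"
proof -
  have BA: "B ** A \<xi> = mat 1"
    using assms(2) matrix_left_right_inverse by blast
  \<comment> \<open>By multilinearity the derivative of \<open>det\<close> is the sum over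
    \<open>i\<close> of the determinants in which row \<open>i\<close> is replaced by its
    derivative.\<close>
  let ?R = "\<lambda>\<beta> i. (\<chi> k. if k = i then (\<chi> j. a \<beta> i j) else A \<xi> $ k) :: complex^'n^'n"
  have "has_wirtinger (\<lambda>\<zeta>. det (A \<zeta>))
    (\<lambda>\<beta>. \<Sum>p\<in>{p. p permutes (UNIV::'n set)}. of_int (sign p) *
        (\<Sum>i\<in>UNIV. a \<beta> i (p i) * (\<Prod>k\<in>UNIV - {i}. A \<xi> $ k $ p k))) \<xi>"
    unfolding det_def
    by (intro has_wirtinger_sum has_wirtinger_cmult has_wirtinger_prod assms) simp
  moreover have "(\<Sum>p\<in>{p. p permutes (UNIV::'n set)}. of_int (sign p) *
        (\<Sum>i\<in>UNIV. a \<beta> i (p i) * (\<Prod>k\<in>UNIV - {i}. A \<xi> $ k $ p k))) =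
      (\<Sum>i\<in>UNIV. det (?R \<beta> i))" (is "?l = _") for \<beta>
  proof -
    have "a \<beta> i (p i) * (\<Prod>k\<in>UNIV - {i}. A \<xi> $ k $ p k) =
        (\<Prod>k\<in>UNIV. ?R \<beta> i $ k $ p k)" for i p
    proof -
      have "(\<Prod>k\<in>UNIV. ?R \<beta> i $ k $ p k) =
          ?R \<beta> i $ i $ p i * (\<Prod>k\<in>UNIV - {i}. ?R \<beta> i $ k $ p k)"
        by (rule prod.remove) simp_all
      also have "(\<Prod>k\<in>UNIV - {i}. ?R \<beta> i $ k $ p k) = (\<Prod>k\<in>UNIV - {i}. A \<xi> $ k $ p k)"
        by (rule prod.cong) auto
      finally show ?thesis by simp
    qed
    then have "?l = (\<Sum>p\<in>{p. p permutes (UNIV::'n set)}. \<Sum>i\<in>UNIV.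
        of_int (sign p) * (\<Prod>k\<in>UNIV. ?R \<beta> i $ k $ p k))"
      by (simp add: sum_distrib_left)
    then show ?thesis
      unfolding det_def by (subst sum.swap) simp
  qed
  moreover have "det (?R \<beta> i) = det (A \<xi>) * (\<Sum>j\<in>UNIV. a \<beta> i j * B $ j $ i)" for \<beta> i
  proof -
    \<comment> \<open>The coefficients that write the replaced row as a combination of the rows of
      \<open>A \<xi>\<close>; Cramer's rule then turns the determinant into
      \<open>x $ i * det (A \<xi>)\<close>.\<close>
    define x :: "complex^'n" where "x = (\<chi> j. a \<beta> i j) v* B"
    have "x v* A \<xi> = (\<chi> j. a \<beta> i j)"
      unfolding x_def by (simp add: vector_matrix_mul_assoc BA)
    then have row: "(\<Sum>k\<in>UNIV. x $ k *s row k (A \<xi>)) = (\<chi> j. a \<beta> i j)"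
      by (simp add: vec_eq_iff vector_matrix_mult_def row_def mult.commute)
    have "?R \<beta> i = (\<chi> k. if k = i then (\<Sum>k\<in>UNIV. x $ k *s row k (A \<xi>)) else row k (A \<xi>))"
      unfolding row by (simp add: row_def vec_eq_iff)
    then have "det (?R \<beta> i) = x $ i * det (A \<xi>)"
      using cramer_lemma_transpose[of i x "A \<xi>"] by (simp only:)
    then show ?thesis
      by (simp add: x_def vector_matrix_mult_def mult.commute)
  qed
  ultimately show ?thesis by (simp add: sum_distrib_left)
qed

subsection \<open>The spectral density\<close>

definition score :: "real \<Rightarrow> complex^'p \<Rightarrow> 'p + 'p \<Rightarrow> complex" where
  "score \<omega> \<xi> \<beta> = (case \<beta> of
     Inl i \<Rightarrow> exp (- (\<i> * of_real \<omega>)) / (1 - \<xi> $ i * exp (- (\<i> * of_real \<omega>)))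
   | Inr i \<Rightarrow> cnj (exp (- (\<i> * of_real \<omega>)) / (1 - \<xi> $ i * exp (- (\<i> * of_real \<omega>)))))"

text \<open>\<open>Theta1\<close> without the distinctness condition. It is open, so derivatives can
  be nested on it, and distinctness enters only through the invertibility of the Szego
  matrix.\<close>

definition polydisc :: "(complex^'p) set" where
  "polydisc = {\<xi>. \<forall>i. cmod (\<xi> $ i) < 1}"

lemma open_polydisc: "open (polydisc :: (complex^'p) set)"
proof -
  have "polydisc = (\<Inter>i\<in>UNIV. {\<xi> :: complex^'p. cmod (\<xi> $ i) < 1})"
    by (auto simp: polydisc_def)
  also have "open \<dots>"
    by (intro open_INT ballI open_Collect_less continuous_intros) auto
  finally show ?thesis .
qed

lemma eventually_polydisc: "\<xi> \<in> polydisc \<Longrightarrow> eventually (\<lambda>\<zeta>. \<zeta> \<in> polydisc) (nhds \<xi>)"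
  by (rule eventually_nhds_in_open[OF open_polydisc])

lemma one_minus_mult_neq_0:
  fixes z w :: complex
  assumes "cmod z < 1" "cmod w \<le> 1"
  shows "1 - z * w \<noteq> 0"
proof
  assume "1 - z * w = 0"
  then have "cmod (z * w) = 1" by simp
  moreover have "cmod (z * w) < 1"
    using assms mult_mono[of "cmod z" "cmod z" "cmod w" 1] by (simp add: norm_mult)
  ultimately show False by simp
qed

lemma polydisc_neq_0:
  assumes "\<xi> \<in> polydisc"
  shows "1 - \<xi> $ i * exp (- (\<i> * complex_of_real \<omega>)) \<noteq> 0"
    "1 - cnj (\<xi> $ i) * cnj (exp (- (\<i> * complex_of_real \<omega>))) \<noteq> 0"
    "1 - \<xi> $ i * cnj (\<xi> $ j) \<noteq> 0"
proof -
  have *: "cmod (\<xi> $ i) < 1" for i using assms by (simp add: polydisc_def)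
  show "1 - \<xi> $ i * exp (- (\<i> * complex_of_real \<omega>)) \<noteq> 0"
    by (rule one_minus_mult_neq_0) (simp_all add: * norm_exp_eq_Re)
  show "1 - cnj (\<xi> $ i) * cnj (exp (- (\<i> * complex_of_real \<omega>))) \<noteq> 0"
    by (rule one_minus_mult_neq_0) (simp_all add: * norm_exp_eq_Re del: exp_cnj)
  show "1 - \<xi> $ i * cnj (\<xi> $ j) \<noteq> 0"
    by (rule one_minus_mult_neq_0) (simp_all add: * less_imp_le)
qed

text \<open>Writing the squared modulus as a product with the conjugate separates the holomorphic
  factors from the antiholomorphic ones, each depending on a single coordinate.\<close>

lemma spectral_density_conv_prod:
  fixes \<xi> :: "complex^'p"
  assumes z: "z = exp (- (\<i> * complex_of_real \<omega>))"
  shows "complex_of_real (spectral_density \<omega> \<xi>) = 1 / (2 * of_real pi) *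
    ((\<Prod>i\<in>UNIV. inverse (1 - \<xi> $ i * z)) * (\<Prod>i\<in>UNIV. inverse (1 - cnj (\<xi> $ i) * cnj z)))"
proof -
  have "complex_of_real ((cmod (\<Prod>i\<in>UNIV. 1 - \<xi> $ i * z))\<^sup>2) =
      (\<Prod>i\<in>UNIV. 1 - \<xi> $ i * z) * (\<Prod>i\<in>UNIV. 1 - cnj (\<xi> $ i) * cnj z)"
    by (subst complex_norm_square) simp
  moreover have "(\<Prod>i\<in>UNIV. inverse (1 - \<xi> $ i * z)) = inverse (\<Prod>i\<in>UNIV. 1 - \<xi> $ i * z)"
    "(\<Prod>i\<in>UNIV. inverse (1 - cnj (\<xi> $ i) * cnj z)) =
      inverse (\<Prod>i\<in>UNIV. 1 - cnj (\<xi> $ i) * cnj z)"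
    using prod_inversef[of "\<lambda>i. 1 - \<xi> $ i * z" UNIV]
      prod_inversef[of "\<lambda>i. 1 - cnj (\<xi> $ i) * cnj z" UNIV] by (simp_all add: o_def)
  ultimately show ?thesis
    unfolding spectral_density_def z[symmetric] of_real_divide of_real_mult by (simp add: field_simps)
qed

lemma has_wirtinger_spectral_density:
  assumes "\<xi> \<in> polydisc"
  shows "has_wirtinger (\<lambda>\<zeta>. complex_of_real (spectral_density \<omega> \<zeta>))
    (\<lambda>\<beta>. complex_of_real (spectral_density \<omega> \<xi>) * score \<omega> \<xi> \<beta>) \<xi>"
proof -
  define z where "z = exp (- (\<i> * complex_of_real \<omega>))"
  have nz: "1 - \<xi> $ i * z \<noteq> 0" "1 - cnj (\<xi> $ i) * cnj z \<noteq> 0" for i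
    using polydisc_neq_0[OF assms] by (simp_all only: z_def not_False_eq_True)
  have 1: "has_wirtinger (\<lambda>\<zeta>. inverse (1 - \<zeta> $ i * z))
      (\<lambda>\<beta>. inverse (1 - \<xi> $ i * z) * (if \<beta> = Inl i then score \<omega> \<xi> \<beta> else 0)) \<xi>" for i
  proof -
    have "((\<lambda>x. inverse (1 - x * z)) has_field_derivative (z / (1 - \<xi> $ i * z)\<^sup>2)) (at (\<xi> $ i))"
      using nz by (auto intro!: derivative_eq_intros simp: power2_eq_square field_simps)
    from has_wirtinger_compose[OF has_wirtinger_coord this] show ?thesis
      by (rule has_wirtinger_eqI)
        (auto simp: score_def z_def[symmetric] power2_eq_square field_simps)
  qed
  have 2: "has_wirtinger (\<lambda>\<zeta>. inverse (1 - cnj (\<zeta> $ i) * cnj z))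
      (\<lambda>\<beta>. inverse (1 - cnj (\<xi> $ i) * cnj z) * (if \<beta> = Inr i then score \<omega> \<xi> \<beta> else 0)) \<xi>" for i
  proof -
    have "((\<lambda>x. inverse (1 - x * cnj z)) has_field_derivative (cnj z / (1 - cnj (\<xi> $ i) * cnj z)\<^sup>2))
        (at (cnj (\<xi> $ i)))"
      using nz by (auto intro!: derivative_eq_intros simp: power2_eq_square field_simps)
    from has_wirtinger_compose[OF has_wirtinger_cnj_coord this] show ?thesis
      by (rule has_wirtinger_eqI)
        (auto simp: score_def z_def[symmetric] power2_eq_square field_simps)
  qed
  \<comment> \<open>Each index \<beta> occurs in exactly one factor of the density, so a single term
    of the two sums survives.\<close>
  have sums: "(\<Sum>i\<in>UNIV. if \<beta> = Inl i then score \<omega> \<xi> \<beta> else 0) +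
      (\<Sum>i\<in>UNIV. if \<beta> = Inr i then score \<omega> \<xi> \<beta> else 0) = score \<omega> \<xi> \<beta>" for \<beta>
    by (cases \<beta>) auto
  have prod1: "has_wirtinger (\<lambda>\<zeta>. \<Prod>i\<in>UNIV. inverse (1 - \<zeta> $ i * z))
      (\<lambda>\<beta>. (\<Prod>i\<in>UNIV. inverse (1 - \<xi> $ i * z)) *
        (\<Sum>i\<in>UNIV. if \<beta> = Inl i then score \<omega> \<xi> \<beta> else 0)) \<xi>"
    by (rule has_wirtinger_prod_log[OF finite 1])
  have prod2: "has_wirtinger (\<lambda>\<zeta>. \<Prod>i\<in>UNIV. inverse (1 - cnj (\<zeta> $ i) * cnj z))
      (\<lambda>\<beta>. (\<Prod>i\<in>UNIV. inverse (1 - cnj (\<xi> $ i) * cnj z)) *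
        (\<Sum>i\<in>UNIV. if \<beta> = Inr i then score \<omega> \<xi> \<beta> else 0)) \<xi>"
    by (rule has_wirtinger_prod_log[OF finite 2])
  have "has_wirtinger (\<lambda>\<zeta>. 1 / (2 * of_real pi) *
      ((\<Prod>i\<in>UNIV. inverse (1 - \<zeta> $ i * z)) * (\<Prod>i\<in>UNIV. inverse (1 - cnj (\<zeta> $ i) * cnj z))))
    (\<lambda>\<beta>. 1 / (2 * of_real pi) *
      ((\<Prod>i\<in>UNIV. inverse (1 - \<xi> $ i * z)) * (\<Prod>i\<in>UNIV. inverse (1 - cnj (\<xi> $ i) * cnj z))) *
      ((\<Sum>i\<in>UNIV. if \<beta> = Inl i then score \<omega> \<xi> \<beta> else 0) +
       (\<Sum>i\<in>UNIV. if \<beta> = Inr i then score \<omega> \<xi> \<beta> else 0))) \<xi>"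
    by (rule has_wirtinger_eqI[OF has_wirtinger_cmult[OF has_wirtinger_mult[OF prod1 prod2],
            of "1 / (2 * of_real pi)"]])
      (simp_all add: algebra_simps add_divide_distrib)
  then show ?thesis
    unfolding spectral_density_conv_prod[OF z_def] sums .
qed

lemma spectral_density_pos:
  assumes "\<xi> \<in> polydisc"
  shows "spectral_density \<omega> \<xi> > 0"
proof -
  have "(\<Prod>i\<in>UNIV. 1 - \<xi> $ i * exp (- (\<i> * complex_of_real \<omega>))) \<noteq> 0"
    unfolding prod_zero_iff[OF finite] using polydisc_neq_0(1)[OF assms] by blast
  then show ?thesis by (simp only: spectral_density_def) simp
qed

text \<open>The density is positive throughout \<open>polydisc\<close>, so the real logarithm agrees
  near \<xi> with the holomorphic \<open>Ln\<close>, to which the chain rule applies.\<close>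

lemma dlogS_eq_score:
  assumes "\<xi> \<in> polydisc"
  shows "dlogS \<beta> \<omega> \<xi> = score \<omega> \<xi> \<beta>"
proof -
  have "(Ln has_field_derivative inverse (complex_of_real (spectral_density \<omega> \<xi>)))
      (at (complex_of_real (spectral_density \<omega> \<xi>)))"
    using spectral_density_pos[OF assms] by (intro has_field_derivative_Ln) (simp add: complex_nonpos_Reals_iff not_le)
  from has_wirtinger_compose[OF has_wirtinger_spectral_density[OF assms] this]
  have "has_wirtinger (\<lambda>\<zeta>. Ln (complex_of_real (spectral_density \<omega> \<zeta>))) (score \<omega> \<xi>) \<xi>"
    using spectral_density_pos[OF assms, of \<omega>] by (simp add: field_simps)
  then have "has_wirtinger (\<lambda>\<zeta>. complex_of_real (ln (spectral_density \<omega> \<zeta>))) (score \<omega> \<xi>) \<xi>"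
    by (rule has_wirtinger_cong)
      (auto intro!: eventually_mono[OF eventually_polydisc[OF assms]] Ln_of_real spectral_density_pos)
  then show ?thesis
    unfolding dlogS_def by (rule has_wirtinger_imp_wirtinger)
qed

text \<open>A score is a Moebius function of one coordinate or its conjugate, of the form
  \<open>z / (1 - x * z)\<close>, and the derivative of that function in \<open>x\<close> is its
  square.\<close>

lemma has_wirtinger_score:
  assumes "\<xi> \<in> polydisc"
  shows "has_wirtinger (\<lambda>\<zeta>. score \<omega> \<zeta> \<gamma>)
    (\<lambda>\<beta>. if \<beta> = \<gamma> then (score \<omega> \<xi> \<gamma>)\<^sup>2 else 0) \<xi>"
proof (cases \<gamma>)
  case (Inl i)
  define z where "z = exp (- (\<i> * complex_of_real \<omega>))"
  have nz: "1 - \<xi> $ i * z \<noteq> 0"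
    using polydisc_neq_0[OF assms] by (simp_all only: z_def not_False_eq_True)
  have "((\<lambda>x. z / (1 - x * z)) has_field_derivative (z / (1 - \<xi> $ i * z))\<^sup>2) (at (\<xi> $ i))"
    using nz by (auto intro!: derivative_eq_intros simp: power2_eq_square field_simps)
  from has_wirtinger_compose[OF has_wirtinger_coord this] show ?thesis
    by (rule has_wirtinger_eqI)
      (auto simp: score_def z_def[symmetric] Inl)
next
  case (Inr i)
  define z where "z = exp (- (\<i> * complex_of_real \<omega>))"
  have nz: "1 - cnj (\<xi> $ i) * cnj z \<noteq> 0"
    using polydisc_neq_0[OF assms] by (simp_all only: z_def not_False_eq_True)
  have "((\<lambda>x. cnj z / (1 - x * cnj z)) has_field_derivative (cnj z / (1 - cnj (\<xi> $ i) * cnj z))\<^sup>2)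
      (at (cnj (\<xi> $ i)))"
    using nz by (auto intro!: derivative_eq_intros simp: power2_eq_square field_simps)
  from has_wirtinger_compose[OF has_wirtinger_cnj_coord this] show ?thesis
    by (rule has_wirtinger_eqI)
      (auto simp: score_def z_def[symmetric] Inr)
qed

text \<open>The first derivative is S times the score \<gamma> on a whole neighbourhood. The product
  rule yields the product of both scores, plus a squared score when \<beta> = \<gamma>, which is
  that same product again.\<close>

lemma wirtinger_wirtinger_spectral_density:
  assumes "\<xi> \<in> polydisc"
  shows "wirtinger \<beta> (wirtinger \<gamma> (\<lambda>\<zeta>. complex_of_real (spectral_density \<omega> \<zeta>))) \<xi>
         / complex_of_real (spectral_density \<omega> \<xi>) =
    (1 + of_bool (\<beta> = \<gamma>)) * score \<omega> \<xi> \<beta> * score \<omega> \<xi> \<gamma>"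
proof -
  have "has_wirtinger (\<lambda>\<zeta>. complex_of_real (spectral_density \<omega> \<zeta>) * score \<omega> \<zeta> \<gamma>)
    (\<lambda>\<beta>. complex_of_real (spectral_density \<omega> \<xi>) * (if \<beta> = \<gamma> then (score \<omega> \<xi> \<gamma>)\<^sup>2 else 0) +
      score \<omega> \<xi> \<gamma> * (complex_of_real (spectral_density \<omega> \<xi>) * score \<omega> \<xi> \<beta>)) \<xi>"
    by (intro has_wirtinger_mult has_wirtinger_spectral_density has_wirtinger_score assms)
  then have "has_wirtinger (wirtinger \<gamma> (\<lambda>\<zeta>. complex_of_real (spectral_density \<omega> \<zeta>)))
    (\<lambda>\<beta>. complex_of_real (spectral_density \<omega> \<xi>) * (if \<beta> = \<gamma> then (score \<omega> \<xi> \<gamma>)\<^sup>2 else 0) +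
      score \<omega> \<xi> \<gamma> * (complex_of_real (spectral_density \<omega> \<xi>) * score \<omega> \<xi> \<beta>)) \<xi>"
    by (rule has_wirtinger_cong)
      (auto intro!: eventually_mono[OF eventually_polydisc[OF assms]]
        simp: has_wirtinger_imp_wirtinger[OF has_wirtinger_spectral_density])
  from has_wirtinger_imp_wirtinger[OF this] spectral_density_pos[OF assms, of \<omega>] show ?thesis
    by (simp add: power2_eq_square field_simps)
qed

subsection \<open>Integrals over the unit circle\<close>

lemma has_integral_Cauchy_unit_circle:
  assumes F: "F holomorphic_on cball 0 1" and w: "cmod w < 1"
  shows "((\<lambda>\<omega>. F (exp (- (\<i> * complex_of_real \<omega>))) / (1 - w * cnj (exp (- (\<i> * complex_of_real \<omega>)))))
    has_integral 2 * of_real pi * F w) {-pi..pi}"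
proof -
  \<comment> \<open>The substitution \<open>\<omega> = pi - t\<close> turns \<open>exp (-\<i> \<omega>)\<close> into \<open>- exp (\<i> t)\<close>, so that Cauchy's formula
     on the library's circle path over \<open>[0, 2 pi]\<close> applies to \<open>u \<mapsto> F (- u)\<close> at the point \<open>- w\<close>.\<close>
  define G where "G u = F (- u)" for u
  have "G holomorphic_on cball 0 1"
    unfolding G_def
    by (rule holomorphic_on_compose_gen[OF _ F, unfolded o_def]) (auto intro!: holomorphic_intros)
  then have "((\<lambda>u. G u / (u - (- w))) has_contour_integral (2 * of_real pi * \<i> * G (- w)))
      (circlepath 0 1)"
    by (rule Cauchy_integral_circlepath_simple) (use w in simp)
  then have "((\<lambda>t. G (cis t) / (cis t + w) * \<i> * cis t) has_integral 2 * of_real pi * \<i> * F w) {0..2*pi}"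
    unfolding circlepath_def by (simp add: has_contour_integral_part_circlepath_iff G_def)
  \<comment> \<open>The factor \<open>- \<i>\<close> cancels the \<i> in
    \<open>dz = \<i> * z * dt\<close>.\<close>
  from has_integral_mult_right[OF this, of "- \<i>"]
  have "((\<lambda>t. G (cis t) * cis t / (cis t + w)) has_integral 2 * of_real pi * F w) (cbox 0 (2*pi))"
    by (simp add: algebra_simps)
  from has_integral_affinity[OF this, of "-1" pi]
  have *: "((\<lambda>\<omega>. G (cis (pi - \<omega>)) * cis (pi - \<omega>) / (cis (pi - \<omega>) + w)) has_integral 2 * of_real pi * F w)
      ((\<lambda>x. pi - x) ` {0..2*pi})"
    by (simp add: algebra_simps)
  have img: "(\<lambda>x. pi - x) ` {0..2*pi} = {-pi..pi}"
    using image_diff_atLeastAtMost[of pi 0 "2*pi"] by simp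
  have "G (cis (pi - \<omega>)) * cis (pi - \<omega>) / (cis (pi - \<omega>) + w) =
      F (exp (- (\<i> * complex_of_real \<omega>))) / (1 - w * cnj (exp (- (\<i> * complex_of_real \<omega>))))" for \<omega>
  proof -
    define z where "z = exp (- (\<i> * complex_of_real \<omega>))"
    have z: "cis (pi - \<omega>) = - z"
      by (simp add: z_def cis_conv_exp[of "- \<omega>", simplified, symmetric] complex_eq_iff)
    have "z * cnj z = 1" by (simp add: z_def complex_norm_square[symmetric])
    moreover have "z \<noteq> 0" by (simp add: z_def)
    \<comment> \<open>On the unit circle \<open>cnj z\<close> is the inverse of \<open>z\<close>, so
      the kernel in \<open>cnj z\<close> is the Cauchy kernel times \<open>z\<close>.\<close>
    ultimately have "z / (z - w) = 1 / (1 - w * cnj z)"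
    proof -
      assume a: "z * cnj z = 1" "z \<noteq> 0"
      have "z - w = z * (1 - w * cnj z)" using a by (simp add: algebra_simps)
      then show ?thesis using a by simp
    qed
    then have "F z * (z / (z - w)) = F z * (1 / (1 - w * cnj z))" by simp
    moreover have "G (- z) * - z / (- z + w) = F z * (z / (z - w))"
      using minus_divide_divide[of "F z * z" "z - w"] by (simp add: G_def)
    ultimately show ?thesis
      by (simp add: z z_def[symmetric])
  qed
  with * img show ?thesis by simp
qed

subsection \<open>Means of products of scores\<close>

lemma score_Inr: "score \<omega> \<xi> (Inr i) = cnj (score \<omega> \<xi> (Inl i))"
  by (simp add: score_def)

text \<open>The Szego kernel of the unit disc, evaluated at pairs of coordinates of \<xi>.\<close>

definition szego :: "complex^'p \<Rightarrow> 'p \<Rightarrow> 'p \<Rightarrow> complex" where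
  "szego \<xi> i j = 1 / (1 - \<xi> $ i * cnj (\<xi> $ j))"

lemma cnj_szego [simp]: "cnj (szego \<xi> i j) = szego \<xi> j i"
  by (simp add: szego_def mult.commute)

text \<open>A factor \<open>z\<close> taken from a holomorphic score cancels the numerator
  \<open>cnj z\<close> of the conjugate score and leaves the kernel to which Cauchy's formula
  applies.\<close>

lemma score_mult_Inr:
  fixes \<xi> :: "complex^'p"
  assumes "z = exp (- (\<i> * complex_of_real \<omega>))"
  shows "z * score \<omega> \<xi> (Inr k) = 1 / (1 - cnj (\<xi> $ k) * cnj z)"
proof -
  have "z * cnj z = 1" by (simp add: assms complex_norm_square[symmetric] norm_exp_eq_Re)
  then show ?thesis by (simp add: score_def assms[symmetric])
qed

lemma holomorphic_on_geometric:
  assumes "cmod a < 1"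
  shows "(\<lambda>z. 1 / (1 - a * z)) holomorphic_on cball 0 1"
proof -
  have "1 - a * z \<noteq> 0" if "z \<in> cball 0 1" for z
    by (rule one_minus_mult_neq_0) (use that assms in auto)
  then show ?thesis by (auto intro!: holomorphic_intros)
qed

lemma integral_score2:
  assumes "\<xi> \<in> polydisc"
  shows "integral {-pi..pi} (\<lambda>\<omega>. score \<omega> \<xi> (Inl i) * score \<omega> \<xi> (Inl j)) = 0"
    and "integral {-pi..pi} (\<lambda>\<omega>. score \<omega> \<xi> (Inl i) * score \<omega> \<xi> (Inr j)) = 2 * of_real pi * szego \<xi> i j"
proof -
  have small: "cmod (\<xi> $ i) < 1" "cmod (cnj (\<xi> $ i)) < 1" for i
    using assms by (auto simp: polydisc_def)
  note holo = holomorphic_on_geometric[OF small(1)]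
  have "(\<lambda>z. (z * (1 / (1 - \<xi> $ i * z))) * (z * (1 / (1 - \<xi> $ j * z)))) holomorphic_on cball 0 1"
    by (intro holomorphic_on_mult holomorphic_on_ident holo)
  \<comment> \<open>With \<open>w = 0\<close> Cauchy's formula is the mean value property, and the
    integrand has a double zero at the origin.\<close>
  from has_integral_Cauchy_unit_circle[OF this, of 0]
  show "integral {-pi..pi} (\<lambda>\<omega>. score \<omega> \<xi> (Inl i) * score \<omega> \<xi> (Inl j)) = 0"
    by (intro integral_unique) (simp add: score_def)
  have eq: "score \<omega> \<xi> (Inl i) * score \<omega> \<xi> (Inr j) =
      1 / (1 - \<xi> $ i * exp (- (\<i> * complex_of_real \<omega>))) /
      (1 - cnj (\<xi> $ j) * cnj (exp (- (\<i> * complex_of_real \<omega>))))" for \<omega>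
  proof -
    have "score \<omega> \<xi> (Inl i) * score \<omega> \<xi> (Inr j) = 1 / (1 - \<xi> $ i * exp (- (\<i> * complex_of_real \<omega>))) *
      (exp (- (\<i> * complex_of_real \<omega>)) * score \<omega> \<xi> (Inr j))"
      by (simp add: score_def)
    then show ?thesis unfolding score_mult_Inr[OF refl] by simp
  qed
  show "integral {-pi..pi} (\<lambda>\<omega>. score \<omega> \<xi> (Inl i) * score \<omega> \<xi> (Inr j)) = 2 * of_real pi * szego \<xi> i j"
    unfolding eq szego_def
    by (rule integral_unique[OF has_integral_Cauchy_unit_circle[OF holo small(2)]])
qed

definition score_mean3 :: "complex^'p \<Rightarrow> 'p + 'p \<Rightarrow> 'p + 'p \<Rightarrow> 'p + 'p \<Rightarrow> complex" where
  "score_mean3 \<xi> \<beta> \<gamma> \<delta> = 1 / (2 * of_real pi) *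
     integral {-pi..pi} (\<lambda>\<omega>. score \<omega> \<xi> \<beta> * score \<omega> \<xi> \<gamma> * score \<omega> \<xi> \<delta>)"

lemma score_mean3_commute:
  "score_mean3 \<xi> \<beta> \<gamma> \<delta> = score_mean3 \<xi> \<beta> \<delta> \<gamma>"
  by (simp add: score_mean3_def mult_ac)

text \<open>One of the two factors \<open>z\<close> cancels against the conjugate score; the other
  is evaluated at \<open>cnj (\<xi> $ k)\<close> by Cauchy's formula. Means of three scores of the
  same type never arise in the trace, because the inverse metric pairs \<open>Inl\<close> only with
  \<open>Inr\<close>.\<close>

lemma score_mean3_holomorphic:
  assumes "\<xi> \<in> polydisc"
  shows "score_mean3 \<xi> (Inl i) (Inl j) (Inr k) = cnj (\<xi> $ k) * szego \<xi> i k * szego \<xi> j k"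
proof -
  have small: "cmod (\<xi> $ i) < 1" "cmod (cnj (\<xi> $ i)) < 1" for i
    using assms by (auto simp: polydisc_def)
  note holo = holomorphic_on_geometric[OF small(1)]
  have eq: "score \<omega> \<xi> (Inl i) * score \<omega> \<xi> (Inl j) * score \<omega> \<xi> (Inr k) =
      exp (- (\<i> * complex_of_real \<omega>)) * (1 / (1 - \<xi> $ i * exp (- (\<i> * complex_of_real \<omega>)))) *
        (1 / (1 - \<xi> $ j * exp (- (\<i> * complex_of_real \<omega>)))) /
      (1 - cnj (\<xi> $ k) * cnj (exp (- (\<i> * complex_of_real \<omega>))))" for \<omega>
  proof -
    have "score \<omega> \<xi> (Inl i) * score \<omega> \<xi> (Inl j) * score \<omega> \<xi> (Inr k) =
      exp (- (\<i> * complex_of_real \<omega>)) * (1 / (1 - \<xi> $ i * exp (- (\<i> * complex_of_real \<omega>)))) *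
        (1 / (1 - \<xi> $ j * exp (- (\<i> * complex_of_real \<omega>)))) *
      (exp (- (\<i> * complex_of_real \<omega>)) * score \<omega> \<xi> (Inr k))"
      by (simp add: score_def)
    then show ?thesis unfolding score_mult_Inr[OF refl] by simp
  qed
  have "(\<lambda>z. z * (1 / (1 - \<xi> $ i * z)) * (1 / (1 - \<xi> $ j * z))) holomorphic_on cball 0 1"
    by (intro holomorphic_on_mult holomorphic_on_ident holo)
  from integral_unique[OF has_integral_Cauchy_unit_circle[OF this small(2)]]
  have "integral {-pi..pi} (\<lambda>\<omega>. score \<omega> \<xi> (Inl i) * score \<omega> \<xi> (Inl j) * score \<omega> \<xi> (Inr k)) =
      2 * of_real pi * (cnj (\<xi> $ k) * szego \<xi> i k * szego \<xi> j k)"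
    unfolding eq szego_def .
  then show "score_mean3 \<xi> (Inl i) (Inl j) (Inr k) = cnj (\<xi> $ k) * szego \<xi> i k * szego \<xi> j k"
    by (simp add: score_mean3_def)
qed

lemma score_mean3_antiholomorphic:
  assumes "\<xi> \<in> polydisc"
  shows "score_mean3 \<xi> (Inr i) (Inr j) (Inl k) = \<xi> $ k * szego \<xi> k i * szego \<xi> k j"
proof -
  have "score_mean3 \<xi> (Inr i) (Inr j) (Inl k) = cnj (score_mean3 \<xi> (Inl i) (Inl j) (Inr k))"
    by (simp add: score_mean3_def score_Inr integral_cnj)
  then show "score_mean3 \<xi> (Inr i) (Inr j) (Inl k) = \<xi> $ k * szego \<xi> k i * szego \<xi> k j"
    by (simp add: score_mean3_holomorphic[OF assms])
qed

section \<open>Metric and connection coefficients\<close>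

lemma metric_polydisc:
  assumes "\<xi> \<in> polydisc"
  shows "metric \<xi> $ Inl i $ Inl j = 0" "metric \<xi> $ Inr i $ Inr j = 0"
    "metric \<xi> $ Inl i $ Inr j = szego \<xi> i j" "metric \<xi> $ Inr i $ Inl j = szego \<xi> j i"
proof -
  have m: "metric \<xi> $ \<beta> $ \<gamma> = 1 / (2 * of_real pi) *
      integral {-pi..pi} (\<lambda>\<omega>. score \<omega> \<xi> \<beta> * score \<omega> \<xi> \<gamma>)" for \<beta> \<gamma>
    by (simp add: metric_def dlogS_eq_score[OF assms])
  show "metric \<xi> $ Inl i $ Inl j = 0" "metric \<xi> $ Inl i $ Inr j = szego \<xi> i j"
    by (simp_all add: m integral_score2[OF assms])
  have "metric \<xi> $ Inr i $ Inl j = metric \<xi> $ Inl j $ Inr i"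
    by (simp add: m mult.commute)
  then show "metric \<xi> $ Inr i $ Inl j = szego \<xi> j i"
    by (simp add: m integral_score2[OF assms])
  have "metric \<xi> $ Inr i $ Inr j = cnj (metric \<xi> $ Inl i $ Inl j)"
    by (simp add: m score_Inr integral_cnj)
  then show "metric \<xi> $ Inr i $ Inr j = 0"
    by (simp add: m integral_score2[OF assms])
qed

text \<open>The skewness is twice the mean of the three scores, so its weight
  \<open>(1 + \<alpha>) / 2\<close> contributes 1 + \<alpha>, and the 1 cancels against the one from
  the second derivative of S.\<close>

lemma Gamma_alpha_polydisc:
  assumes "\<xi> \<in> polydisc"
  shows "Gamma_alpha \<alpha> \<xi> \<beta> \<gamma> \<delta> = (of_bool (\<beta> = \<gamma>) - of_real \<alpha>) * score_mean3 \<xi> \<beta> \<gamma> \<delta>"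
proof -
  have "Gamma_m \<xi> \<beta> \<gamma> \<delta> = (1 + of_bool (\<beta> = \<gamma>)) * score_mean3 \<xi> \<beta> \<gamma> \<delta>"
    by (simp add: Gamma_m_def wirtinger_wirtinger_spectral_density[OF assms] dlogS_eq_score[OF assms]
        score_mean3_def mult.assoc)
  moreover have "skewness_T \<xi> \<beta> \<gamma> \<delta> = 2 * score_mean3 \<xi> \<beta> \<gamma> \<delta>"
    by (simp add: skewness_T_def dlogS_eq_score[OF assms] score_mean3_def)
  ultimately show ?thesis
    by (simp add: Gamma_alpha_def algebra_simps add_divide_distrib)
qed

subsection \<open>Positive definite matrices\<close>

text \<open>Carries positivity along a path without zeros: applied to a determinant deformed from
  the identity, and to \<open>phi\<close> along a ray from the origin.\<close>

lemma IVT_nonzero_pos: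
  fixes f :: "real \<Rightarrow> real"
  assumes "continuous_on {0..1} f" "\<And>t. t \<in> {0..1} \<Longrightarrow> f t \<noteq> 0" "f 0 > 0"
  shows "f 1 > 0"
proof (rule ccontr)
  assume "\<not> f 1 > 0"
  then have "\<exists>t\<ge>0. t \<le> 1 \<and> f t = 0"
    using assms by (intro IVT2') auto
  then show False using assms(2) by auto
qed

lemma cnj_det:
  fixes A :: "complex^'n^'n"
  shows "cnj (det A) = det (\<chi> i j. cnj (A $ i $ j))"
  by (simp add: det_def)

lemma det_positive_definite:
  fixes A :: "complex^'n^'n"
  assumes herm: "\<And>i j. cnj (A $ i $ j) = A $ j $ i"
    and pos: "\<And>c :: complex^'n. c \<noteq> 0 \<Longrightarrow> Re (\<Sum>i\<in>UNIV. \<Sum>j\<in>UNIV. cnj (c $ i) * A $ i $ j * c $ j) > 0"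
  obtains r where "r > 0" "det A = complex_of_real r"
proof -
  \<comment> \<open>The determinant is real and nonzero along the segment from the identity to \<open>A\<close>.\<close>
  define M :: "real \<Rightarrow> complex^'n^'n" where
    "M t = (\<chi> i j. of_real (1 - t) * of_bool (i = j) + of_real t * A $ i $ j)" for t
  have real_det: "Im (det (M t)) = 0" for t
  proof -
    have "(\<chi> i j. cnj (M t $ i $ j)) = transpose (M t)"
      by (auto simp: M_def transpose_def vec_eq_iff herm)
    then have "cnj (det (M t)) = det (M t)"
      by (simp add: cnj_det det_transpose)
    then show ?thesis by (simp add: complex_eq_iff)
  qed
  have nz: "det (M t) \<noteq> 0" if t: "t \<in> {0..1}" for t
  proof -
    have "c = 0" if "M t *v c = 0" for c
    proof (rule ccontr)
      assume c: "c \<noteq> 0"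
      \<comment> \<open>Pairing \<open>M t *v c\<close> with \<open>c\<close> gives
        \<open>(1 - t)\<close> times the squared norm of \<open>c\<close> plus \<open>t\<close>
        times the form of \<open>A\<close>, which cannot vanish for \<open>t\<close> in the unit
        interval.\<close>
      have "0 = Re (\<Sum>i\<in>UNIV. cnj (c $ i) * (M t *v c) $ i)"
        using that by simp
      also have "(\<Sum>i\<in>UNIV. cnj (c $ i) * (M t *v c) $ i) =
          (\<Sum>i\<in>UNIV. \<Sum>j\<in>UNIV. of_real (1 - t) * (if i = j then cnj (c $ i) * c $ j else 0)
            + of_real t * (cnj (c $ i) * A $ i $ j * c $ j))"
        unfolding matrix_vector_mult_def sum_distrib_left vec_lambda_beta
        by (intro sum.cong refl) (auto simp: M_def algebra_simps)
      also have "\<dots> = of_real (1 - t) * (\<Sum>i\<in>UNIV. cnj (c $ i) * c $ i) +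
          of_real t * (\<Sum>i\<in>UNIV. \<Sum>j\<in>UNIV. cnj (c $ i) * A $ i $ j * c $ j)"
        by (simp add: sum.distrib sum_distrib_left[symmetric])
      also have "(\<Sum>i\<in>UNIV. cnj (c $ i) * c $ i) = of_real (\<Sum>i\<in>UNIV. (cmod (c $ i))\<^sup>2)"
        unfolding of_real_sum complex_norm_square by (simp add: mult.commute)
      finally have 0: "0 = (1 - t) * (\<Sum>i\<in>UNIV. (cmod (c $ i))\<^sup>2) +
          t * Re (\<Sum>i\<in>UNIV. \<Sum>j\<in>UNIV. cnj (c $ i) * A $ i $ j * c $ j)"
        by simp
      obtain i where "c $ i \<noteq> 0" using c by (auto simp: vec_eq_iff)
      then have norm_pos: "(\<Sum>i\<in>UNIV. (cmod (c $ i))\<^sup>2) > 0"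
        by (intro sum_pos2[of _ i]) auto
      show False
      proof (cases "t = 0")
        case True
        then show False using 0 norm_pos by simp
      next
        case False
        then have "t * Re (\<Sum>i\<in>UNIV. \<Sum>j\<in>UNIV. cnj (c $ i) * A $ i $ j * c $ j) > 0"
          using t pos[OF c] by auto
        moreover have "(1 - t) * (\<Sum>i\<in>UNIV. (cmod (c $ i))\<^sup>2) \<ge> 0"
          using t norm_pos by auto
        ultimately show False using 0 by linarith
      qed
    qed
    then have "invertible (M t)"
      unfolding invertible_left_inverse matrix_left_invertible_ker by blast
    then show ?thesis by (simp add: invertible_det_nz)
  qed
  have "M 0 = mat 1" "M 1 = A"
    by (auto simp: M_def mat_def vec_eq_iff)
  moreover have "Re (det (M 1)) > 0"
  proof (rule IVT_nonzero_pos)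
    show "continuous_on {0..1} (\<lambda>t. Re (det (M t)))"
      unfolding det_def M_def by (auto intro!: continuous_intros)
    show "Re (det (M t)) \<noteq> 0" if "t \<in> {0..1}" for t
      using nz[OF that] real_det[of t] by (auto simp: complex_eq_iff)
  qed (simp add: \<open>M 0 = mat 1\<close>)
  ultimately show ?thesis
    using that[of "Re (det A)"] real_det[of 1] by (simp add: complex_eq_iff)
qed

subsection \<open>The Szego matrix and the function phi\<close>

text \<open>Expanding each entry as a geometric series exhibits the matrix as a Gram matrix: the
  degree \<open>n\<close> part of the quadratic form is a squared modulus.\<close>

lemma szego_form_sums:
  fixes c :: "complex^'p"
  assumes "\<xi> \<in> polydisc"
  shows "(\<lambda>n. complex_of_real ((cmod (\<Sum>j\<in>UNIV. c $ j * cnj (\<xi> $ j) ^ n))\<^sup>2)) sums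
    (\<Sum>i\<in>UNIV. \<Sum>j\<in>UNIV. cnj (c $ i) * szego \<xi> i j * c $ j)"
proof -
  have "(\<lambda>n. \<Sum>i\<in>UNIV. \<Sum>j\<in>UNIV. cnj (c $ i) * (\<xi> $ i * cnj (\<xi> $ j)) ^ n * c $ j) sums
    (\<Sum>i\<in>UNIV. \<Sum>j\<in>UNIV. cnj (c $ i) * szego \<xi> i j * c $ j)"
  proof (intro sums_sum sums_mult sums_mult2)
    fix i j
    have "cmod (\<xi> $ i) * cmod (\<xi> $ j) < 1"
      using assms mult_strict_mono[of "cmod (\<xi> $ i)" 1 "cmod (\<xi> $ j)" 1] by (simp add: polydisc_def)
    then show "(\<lambda>n. (\<xi> $ i * cnj (\<xi> $ j)) ^ n) sums szego \<xi> i j"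
      unfolding szego_def by (intro geometric_sums) (simp add: norm_mult)
  qed
  moreover have "(\<Sum>i\<in>UNIV. \<Sum>j\<in>UNIV. cnj (c $ i) * (\<xi> $ i * cnj (\<xi> $ j)) ^ n * c $ j) =
      complex_of_real ((cmod (\<Sum>j\<in>UNIV. c $ j * cnj (\<xi> $ j) ^ n))\<^sup>2)" for n
    unfolding complex_norm_square cnj_sum sum_product
    by (subst sum.swap) (simp add: power_mult_distrib mult_ac)
  ultimately show ?thesis by simp
qed

lemma vandermonde_injective:
  fixes c y :: "'n::finite \<Rightarrow> 'a::field"
  assumes "\<And>n. (\<Sum>j\<in>UNIV. c j * y j ^ n) = 0" "inj y"
  shows "c k = 0"
proof -
  have *: "(\<Sum>j\<in>UNIV. c j * poly q (y j)) = 0" for q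
  proof -
    have "(\<Sum>j\<in>UNIV. c j * poly q (y j)) = (\<Sum>n\<le>degree q. coeff q n * (\<Sum>j\<in>UNIV. c j * y j ^ n))"
      unfolding poly_altdef sum_distrib_left by (subst sum.swap) (simp add: mult_ac)
    then show ?thesis using assms(1) by simp
  qed
  \<comment> \<open>A power sum identity holds for every polynomial; a Lagrange polynomial isolates \<open>c k\<close>.\<close>
  define q where "q = (\<Prod>j\<in>UNIV - {k}. [:- y j, 1:])"
  have "poly q (y j) = 0" if "j \<noteq> k" for j
    using that by (auto simp: q_def poly_prod)
  then have "(\<Sum>j\<in>UNIV. c j * poly q (y j)) = (\<Sum>j\<in>UNIV. if j = k then c k * poly q (y k) else 0)"
    by (intro sum.cong) auto
  then have "c k * poly q (y k) = 0" using *[of q] by simp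
  moreover have "poly q (y k) \<noteq> 0"
    using assms(2) by (auto simp: q_def poly_prod dest: injD)
  ultimately show ?thesis by simp
qed

lemma Theta1_subset_polydisc: "Theta1 \<subseteq> polydisc"
  by (auto simp: Theta1_def polydisc_def)

text \<open>If the quadratic form vanished, all its squared moduli would vanish, and distinct nodes
  would force \<open>c = 0\<close> by the Vandermonde argument. This is where distinctness of the
  coordinates is used.\<close>

lemma det_szego_pos:
  fixes \<xi> :: "complex^'p"
  assumes "\<xi> \<in> Theta1"
  obtains r where "r > 0" "det (\<chi> i j. szego \<xi> i j) = complex_of_real r"
proof (rule det_positive_definite)
  show "cnj ((\<chi> i j. szego \<xi> i j) $ i $ j) = (\<chi> i j. szego \<xi> i j) $ j $ i" for i j
    by simp
next
  fix c :: "complex^'p"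
  assume "c \<noteq> 0"
  let ?S = "\<lambda>n. \<Sum>j\<in>UNIV. c $ j * cnj (\<xi> $ j) ^ n"
  have "\<exists>n. ?S n \<noteq> 0"
  proof (rule ccontr)
    assume "\<nexists>n. ?S n \<noteq> 0"
    moreover have "inj (\<lambda>j. cnj (\<xi> $ j))"
      using assms by (auto simp: inj_def Theta1_def)
    ultimately have "c $ k = 0" for k
      by (intro vandermonde_injective[of "\<lambda>j. c $ j" "\<lambda>j. cnj (\<xi> $ j)"]) auto
    then show False using \<open>c \<noteq> 0\<close> by (simp add: vec_eq_iff)
  qed
  then obtain n where n: "?S n \<noteq> 0" by blast
  have "\<xi> \<in> polydisc" using assms Theta1_subset_polydisc by blast
  from sums_Re[OF szego_form_sums[OF this]]
  have S: "(\<lambda>n. (cmod (?S n))\<^sup>2) sums Re (\<Sum>i\<in>UNIV. \<Sum>j\<in>UNIV. cnj (c $ i) * szego \<xi> i j * c $ j)"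
    by simp
  have "0 < (\<Sum>n. (cmod (?S n))\<^sup>2)"
    by (rule suminf_pos2[OF sums_summable[OF S], of n]) (use n in auto)
  then show "Re (\<Sum>i\<in>UNIV. \<Sum>j\<in>UNIV. cnj (c $ i) * (\<chi> i j. szego \<xi> i j) $ i $ j * c $ j) > 0"
    using sums_unique[OF S] by simp
qed (use that in blast)

text \<open>Exchanging \<open>i\<close> and \<open>j\<close> conjugates the factors, so
  \<open>phi\<close> is real. It equals 1 at the origin and has no zero on the segment from there to
  \<xi>.\<close>

lemma phi_pos:
  fixes \<xi> :: "complex^'p"
  assumes "\<xi> \<in> polydisc"
  obtains r where "r > 0" "phi \<xi> = complex_of_real r"
proof -
  have im: "Im (phi \<zeta>) = 0" for \<zeta> :: "complex^'p"
  proof -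
    have "cnj (phi \<zeta>) = phi \<zeta>"
      unfolding phi_def by (subst prod.swap) (simp add: mult.commute)
    then show ?thesis by (simp add: complex_eq_iff)
  qed
  have "Re (phi (1 *\<^sub>R \<xi>)) > 0"
  proof (rule IVT_nonzero_pos)
    show "continuous_on {0..1} (\<lambda>t. Re (phi (t *\<^sub>R \<xi>)))"
      unfolding phi_def by (auto intro!: continuous_intros)
    show "Re (phi (t *\<^sub>R \<xi>)) \<noteq> 0" if "t \<in> {0..1}" for t
    proof -
      have "cmod ((t *\<^sub>R \<xi>) $ i) < 1" for i
        using that assms mult_left_le_one_le[of "cmod (\<xi> $ i)" t]
        by (auto simp: polydisc_def intro: le_less_trans)
      then have "t *\<^sub>R \<xi> \<in> polydisc" unfolding polydisc_def by blast
      then have "phi (t *\<^sub>R \<xi>) \<noteq> 0"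
        unfolding phi_def prod_zero_iff[OF finite] using polydisc_neq_0(3) by blast
      then show ?thesis using im by (auto simp: complex_eq_iff)
    qed
  qed (simp add: phi_def)
  then show ?thesis
    using that[of "Re (phi \<xi>)"] im[of \<xi>] by (simp add: complex_eq_iff)
qed

section \<open>Logarithmic derivatives of the kernel, of \<open>phi\<close> and of the Jeffreys
  prior\<close>

definition dlog_szego :: "complex^'p \<Rightarrow> 'p + 'p \<Rightarrow> 'p \<Rightarrow> 'p \<Rightarrow> complex" where
  "dlog_szego \<xi> \<beta> i j = szego \<xi> i j *
     (case \<beta> of Inl k \<Rightarrow> if i = k then cnj (\<xi> $ j) else 0 | Inr k \<Rightarrow> if j = k then \<xi> $ i else 0)"

text \<open>The factor is the reciprocal of the kernel, hence the minus sign. The multiplicative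
  shape is the one \<open>has_wirtinger_prod_log\<close> expects for \<open>phi\<close>.\<close>

lemma has_wirtinger_one_minus_coord_mult_cnj:
  assumes "\<xi> \<in> polydisc"
  shows "has_wirtinger (\<lambda>\<zeta>. 1 - \<zeta> $ i * cnj (\<zeta> $ j))
    (\<lambda>\<beta>. (1 - \<xi> $ i * cnj (\<xi> $ j)) * (- dlog_szego \<xi> \<beta> i j)) \<xi>"
proof (rule has_wirtinger_eqI[OF has_wirtinger_add[OF has_wirtinger_const has_wirtinger_cmult[OF
        has_wirtinger_mult[OF has_wirtinger_coord has_wirtinger_cnj_coord], of "-1"]]])
  show "1 - \<zeta> $ i * cnj (\<zeta> $ j) = 1 + - 1 * (\<zeta> $ i * cnj (\<zeta> $ j))" for \<zeta> :: "complex^'a"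
    by simp
  show "(1 - \<xi> $ i * cnj (\<xi> $ j)) * (- dlog_szego \<xi> \<beta> i j) =
      0 + - 1 * (\<xi> $ i * (if \<beta> = Inr j then 1 else 0) + cnj (\<xi> $ j) * (if \<beta> = Inl i then 1 else 0))" for \<beta>
    using polydisc_neq_0(3)[OF assms, of i j]
    by (cases \<beta>) (auto simp: dlog_szego_def szego_def simp del: right_minus_eq)
qed

lemma has_wirtinger_szego:
  assumes "\<xi> \<in> polydisc"
  shows "has_wirtinger (\<lambda>\<zeta>. szego \<zeta> i j) (\<lambda>\<beta>. szego \<xi> i j * dlog_szego \<xi> \<beta> i j) \<xi>"
proof -
  define w where "w = 1 - \<xi> $ i * cnj (\<xi> $ j)"
  have w: "w \<noteq> 0" unfolding w_def by (rule polydisc_neq_0(3)[OF assms])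
  have "(inverse has_field_derivative - (1 / w\<^sup>2)) (at w)"
    using w by (auto intro!: derivative_eq_intros simp: power2_eq_square field_simps)
  from has_wirtinger_compose[OF has_wirtinger_one_minus_coord_mult_cnj[OF assms] this[unfolded w_def]]
  show ?thesis
    by (rule has_wirtinger_eqI)
      (use w in \<open>simp_all add: szego_def w_def[symmetric] inverse_eq_divide power2_eq_square\<close>)
qed

lemma has_wirtinger_phi:
  assumes "\<xi> \<in> polydisc"
  shows "has_wirtinger phi (\<lambda>\<beta>. phi \<xi> * - (\<Sum>i\<in>UNIV. \<Sum>j\<in>UNIV. dlog_szego \<xi> \<beta> i j)) \<xi>"
  unfolding phi_def sum_negf[symmetric]
  by (intro has_wirtinger_prod_log finite has_wirtinger_one_minus_coord_mult_cnj assms)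

lemma jeffreys_prior_polydisc:
  "\<xi> \<in> polydisc \<Longrightarrow> jeffreys_prior \<xi> = det (\<chi> i j. szego \<xi> i j)"
  by (simp add: jeffreys_prior_def metric_polydisc)

text \<open>Jacobi's formula for the Szego matrix, transferred to the prior through the closed form
  of the metric near \<xi>.\<close>

lemma has_wirtinger_jeffreys_prior:
  assumes "\<xi> \<in> polydisc" "(\<chi> i j. szego \<xi> i j) ** H = mat 1"
  shows "has_wirtinger jeffreys_prior (\<lambda>\<beta>. jeffreys_prior \<xi> *
    (\<Sum>i\<in>UNIV. \<Sum>j\<in>UNIV. szego \<xi> i j * dlog_szego \<xi> \<beta> i j * H $ j $ i)) \<xi>"
proof -
  have "has_wirtinger (\<lambda>\<zeta>. det (\<chi> i j. szego \<zeta> i j)) (\<lambda>\<beta>. det (\<chi> i j. szego \<xi> i j) *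
    (\<Sum>i\<in>UNIV. \<Sum>j\<in>UNIV. szego \<xi> i j * dlog_szego \<xi> \<beta> i j * H $ j $ i)) \<xi>"
    using has_wirtinger_szego[OF assms(1)] assms(2) by (intro has_wirtinger_det) simp_all
  then show ?thesis
    unfolding jeffreys_prior_polydisc[OF assms(1)]
    by (rule has_wirtinger_cong)
      (auto intro!: eventually_mono[OF eventually_polydisc[OF assms(1)]] simp: jeffreys_prior_polydisc)
qed

subsection \<open>The trace of the connection\<close>

lemma sum_UNIV_sum:
  fixes f :: "'a::finite + 'b::finite \<Rightarrow> 'c::comm_monoid_add"
  shows "(\<Sum>\<beta>\<in>UNIV. f \<beta>) = (\<Sum>i\<in>UNIV. f (Inl i)) + (\<Sum>i\<in>UNIV. f (Inr i))"
  unfolding UNIV_Plus_UNIV[symmetric] by (subst sum.Plus) simp_all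

lemma matrix_inv_eqI:
  fixes A :: "'a::semiring_1^'n^'m"
  assumes "A ** B = mat 1" "B ** A = mat 1"
  shows "matrix_inv A = B"
  unfolding matrix_inv_def
proof (rule some_equality)
  fix C
  assume C: "A ** C = mat 1 \<and> C ** A = mat 1"
  have "C = (B ** A) ** C" unfolding assms(2) by simp
  also have "\<dots> = B ** (A ** C)" by (rule matrix_mul_assoc[symmetric])
  also have "\<dots> = B" using C by simp
  finally show "C = B" .
qed (use assms in simp)

text \<open>The metric is block antidiagonal with blocks K and its transpose, so its inverse has the
  transpose of \<open>H\<close> and \<open>H\<close> as antidiagonal blocks.\<close>

lemma inv_metric_polydisc:
  fixes \<xi> :: "complex^'p"
  assumes "\<xi> \<in> polydisc" and KH: "(\<chi> i j. szego \<xi> i j) ** H = mat 1"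
  shows "inv_metric \<xi> $ Inl i $ Inl j = 0" "inv_metric \<xi> $ Inr i $ Inr j = 0"
    "inv_metric \<xi> $ Inl i $ Inr j = H $ j $ i" "inv_metric \<xi> $ Inr i $ Inl j = H $ i $ j"
proof -
  define B :: "complex^('p + 'p)^('p + 'p)" where
    "B = (\<chi> \<beta> \<gamma>. case \<beta> of Inl i \<Rightarrow> (case \<gamma> of Inl j \<Rightarrow> 0 | Inr j \<Rightarrow> H $ j $ i)
                       | Inr i \<Rightarrow> (case \<gamma> of Inl j \<Rightarrow> H $ i $ j | Inr j \<Rightarrow> 0))"
  have HK: "H ** (\<chi> i j. szego \<xi> i j) = mat 1"
    using KH matrix_left_right_inverse by blast
  have KH': "(\<Sum>l\<in>UNIV. szego \<xi> i l * H $ l $ j) = of_bool (i = j)" for i j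
    using arg_cong[OF KH, of "\<lambda>M. M $ i $ j"] by (simp add: matrix_matrix_mult_def mat_def)
  have HK': "(\<Sum>l\<in>UNIV. szego \<xi> l j * H $ i $ l) = of_bool (i = j)" for i j
    using arg_cong[OF HK, of "\<lambda>M. M $ i $ j"]
    by (simp add: matrix_matrix_mult_def mat_def mult.commute)
  have "(metric \<xi> ** B) $ \<beta> $ \<gamma> = mat 1 $ \<beta> $ \<gamma>" for \<beta> \<gamma>
    by (cases \<beta>; cases \<gamma>)
      (auto simp: matrix_matrix_mult_def sum_UNIV_sum metric_polydisc[OF assms(1)] B_def mat_def KH' HK')
  then have right: "metric \<xi> ** B = mat 1" by (simp add: vec_eq_iff)
  then have "B ** metric \<xi> = mat 1" using matrix_left_right_inverse by blast
  with right have "inv_metric \<xi> = B"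
    unfolding inv_metric_def by (rule matrix_inv_eqI)
  then show "inv_metric \<xi> $ Inl i $ Inl j = 0" "inv_metric \<xi> $ Inr i $ Inr j = 0"
    "inv_metric \<xi> $ Inl i $ Inr j = H $ j $ i" "inv_metric \<xi> $ Inr i $ Inl j = H $ i $ j"
    by (simp_all add: B_def)
qed

lemma trace_Gamma_alpha_up:
  fixes \<xi> :: "complex^'p"
  assumes \<xi>: "\<xi> \<in> polydisc" and KH: "(\<chi> i j. szego \<xi> i j) ** H = mat 1"
  shows "(\<Sum>\<gamma>\<in>UNIV. Gamma_alpha_up \<alpha> \<xi> \<beta> \<gamma> \<gamma>) =
    (\<Sum>i\<in>UNIV. \<Sum>j\<in>UNIV. szego \<xi> i j * dlog_szego \<xi> \<beta> i j * H $ j $ i)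
    - 2 * of_real \<alpha> * (\<Sum>i\<in>UNIV. \<Sum>j\<in>UNIV. dlog_szego \<xi> \<beta> i j)"
proof -
  have HK: "H ** (\<chi> i j. szego \<xi> i j) = mat 1"
    using KH matrix_left_right_inverse by blast
  have KH1: "(\<Sum>l\<in>UNIV. szego \<xi> i l * H $ l $ i) = 1" for i
    using arg_cong[OF KH, of "\<lambda>M. M $ i $ i"] by (simp add: matrix_matrix_mult_def mat_def)
  have HK1: "(\<Sum>l\<in>UNIV. szego \<xi> l i * H $ i $ l) = 1" for i
    using arg_cong[OF HK, of "\<lambda>M. M $ i $ i"]
    by (simp add: matrix_matrix_mult_def mat_def mult.commute)
  \<comment> \<open>Both contractions, \<gamma> = \<open>Inl j\<close> against \<open>Inr l\<close>
    and \<gamma> = \<open>Inr l\<close> against \<open>Inl j\<close>, produce this same term by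
    symmetry of the mean; only the Kronecker delta differs.\<close>
  define X where "X j l = score_mean3 \<xi> \<beta> (Inl j) (Inr l) * H $ l $ j" for j l
  have "(\<Sum>\<gamma>\<in>UNIV. Gamma_alpha_up \<alpha> \<xi> \<beta> \<gamma> \<gamma>) =
      (\<Sum>j\<in>UNIV. \<Sum>l\<in>UNIV. (of_bool (\<beta> = Inl j) - of_real \<alpha>) * X j l) +
      (\<Sum>l\<in>UNIV. \<Sum>j\<in>UNIV. (of_bool (\<beta> = Inr l) - of_real \<alpha>) * X j l)"
    by (simp add: Gamma_alpha_up_def sum_UNIV_sum Gamma_alpha_polydisc[OF \<xi>] inv_metric_polydisc[OF assms]
        X_def score_mean3_commute[of \<xi> \<beta> "Inr _" "Inl _"] mult.assoc)
  also have "\<dots> = (\<Sum>j\<in>UNIV. \<Sum>l\<in>UNIV. (of_bool (\<beta> = Inl j) + of_bool (\<beta> = Inr l)) * X j l)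
      - 2 * of_real \<alpha> * (\<Sum>j\<in>UNIV. \<Sum>l\<in>UNIV. X j l)"
    by (subst (2) sum.swap)
      (simp add: sum.distrib[symmetric] sum_subtractf[symmetric] sum_distrib_left algebra_simps)
  \<comment> \<open>The delta makes two of the three scores equal, so the mean contains a squared
    kernel entry: one kernel factor times its logarithmic derivative.\<close>
  also have "(\<Sum>j\<in>UNIV. \<Sum>l\<in>UNIV. (of_bool (\<beta> = Inl j) + of_bool (\<beta> = Inr l)) * X j l) =
      (\<Sum>i\<in>UNIV. \<Sum>j\<in>UNIV. szego \<xi> i j * dlog_szego \<xi> \<beta> i j * H $ j $ i)"
    by (intro sum.cong refl; cases \<beta>)
      (auto simp: X_def dlog_szego_def score_mean3_holomorphic[OF \<xi>] score_mean3_antiholomorphic[OF \<xi>]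
        score_mean3_commute[of \<xi> "Inr _" "Inl _" "Inr _"])
  \<comment> \<open>Without the delta one index is free, and summing over it pairs a row or column
    of K with \<open>H\<close> to give 1; a single logarithmic derivative remains.\<close>
  also have "(\<Sum>j\<in>UNIV. \<Sum>l\<in>UNIV. X j l) = (\<Sum>i\<in>UNIV. \<Sum>j\<in>UNIV. dlog_szego \<xi> \<beta> i j)"
  proof (cases \<beta>)
    case (Inl k)
    have "(\<Sum>j\<in>UNIV. \<Sum>l\<in>UNIV. X j l) = (\<Sum>l\<in>UNIV. \<Sum>j\<in>UNIV. X j l)"
      by (rule sum.swap)
    also have "\<dots> = (\<Sum>l\<in>UNIV. cnj (\<xi> $ l) * szego \<xi> k l * (\<Sum>j\<in>UNIV. szego \<xi> j l * H $ l $ j))"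
      by (simp add: X_def Inl score_mean3_holomorphic[OF \<xi>] sum_distrib_left mult.assoc)
    also have "\<dots> = (\<Sum>j\<in>UNIV. \<Sum>i\<in>UNIV. dlog_szego \<xi> \<beta> i j)"
      unfolding HK1 by (simp add: dlog_szego_def Inl if_distrib mult.commute cong: if_cong)
    finally show ?thesis by (subst sum.swap)
  next
    case (Inr k)
    have "(\<Sum>j\<in>UNIV. \<Sum>l\<in>UNIV. X j l) =
        (\<Sum>j\<in>UNIV. \<xi> $ j * szego \<xi> j k * (\<Sum>l\<in>UNIV. szego \<xi> j l * H $ l $ j))"
      by (simp add: X_def Inr score_mean3_antiholomorphic[OF \<xi>]
          score_mean3_commute[of \<xi> "Inr _" "Inl _" "Inr _"] sum_distrib_left mult.assoc)
    also have "\<dots> = (\<Sum>i\<in>UNIV. \<Sum>j\<in>UNIV. dlog_szego \<xi> \<beta> i j)"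
      unfolding KH1 by (simp add: dlog_szego_def Inr if_distrib mult.commute cong: if_cong)
    finally show ?thesis .
  qed
  finally show ?thesis .
qed

subsection \<open>The parallel prior\<close>

theorem mainTheorem6:
  fixes \<kappa> :: real
  shows "alpha_parallel_prior ((1 - \<kappa>) / 2) (Theta1 :: (complex^'p) set) (kappa_prior \<kappa>)"
  unfolding alpha_parallel_prior_def
proof (intro ballI)
  fix \<xi> :: "complex^'p"
  assume T: "\<xi> \<in> Theta1"
  then have \<xi>: "\<xi> \<in> polydisc" using Theta1_subset_polydisc by blast
  obtain d where d: "d > 0" "det (\<chi> i j. szego \<xi> i j) = complex_of_real d"
    using det_szego_pos[OF T] .
  obtain r where r: "r > 0" "phi \<xi> = complex_of_real r"
    using phi_pos[OF \<xi>] .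
  have "invertible ((\<chi> i j. szego \<xi> i j) :: complex^'p^'p)"
    using d by (simp add: invertible_det_nz)
  then obtain H where KH: "(\<chi> i j. szego \<xi> i j) ** H = mat 1"
    by (auto simp: invertible_def)
  let ?s = "complex_of_real (- \<kappa> + 1)"
  let ?L = "\<lambda>\<beta>. \<Sum>\<gamma>\<in>UNIV. Gamma_alpha_up ((1 - \<kappa>) / 2) \<xi> \<beta> \<gamma> \<gamma>"
  \<comment> \<open>Positivity of \<open>phi \<xi>\<close> keeps it off the branch cut of the
    complex power.\<close>
  have "((\<lambda>z. z powr ?s) has_field_derivative (?s * phi \<xi> powr (?s - 1))) (at (phi \<xi>))"
    using r by (intro has_field_derivative_powr) (simp add: complex_nonpos_Reals_iff not_le)
  from has_wirtinger_mult[OF has_wirtinger_compose[OF has_wirtinger_phi[OF \<xi>] this]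
      has_wirtinger_jeffreys_prior[OF \<xi> KH]]
  have W: "has_wirtinger (kappa_prior \<kappa>) (\<lambda>\<beta>. ?L \<beta> * kappa_prior \<kappa> \<xi>) \<xi>"
  proof (rule has_wirtinger_eqI)
    fix \<beta> :: "'p + 'p"
    have "phi \<xi> powr (?s - 1) * phi \<xi> = phi \<xi> powr ?s"
      using r powr_diff[of "phi \<xi>" ?s 1] by simp
    then have pow: "?s * phi \<xi> powr (?s - 1) * (phi \<xi> * - y) = - (?s * phi \<xi> powr ?s * y)" for y
      by (metis mult.assoc mult_minus_right)
    \<comment> \<open>This fixes \<alpha>: the trace contributes -2\<alpha> times the summed
      logarithmic derivatives, the power of \<open>phi\<close> contributes -(1 - \<kappa>) times
      them.\<close>
    have two: "2 * complex_of_real ((1 - \<kappa>) / 2) = ?s"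
      by simp
    have "(x - s * y) * (p * J) = p * (J * x) + J * - (s * p * y)" for x y s p J :: complex
      by (simp add: algebra_simps)
    then show "?L \<beta> * kappa_prior \<kappa> \<xi> =
      phi \<xi> powr ?s * (jeffreys_prior \<xi> *
        (\<Sum>i\<in>UNIV. \<Sum>j\<in>UNIV. szego \<xi> i j * dlog_szego \<xi> \<beta> i j * H $ j $ i)) +
      jeffreys_prior \<xi> * (?s * phi \<xi> powr (?s - 1) *
        (phi \<xi> * - (\<Sum>i\<in>UNIV. \<Sum>j\<in>UNIV. dlog_szego \<xi> \<beta> i j)))"
      unfolding trace_Gamma_alpha_up[OF \<xi> KH] kappa_prior_def pow two .
  qed (simp add: kappa_prior_def)
  have "kappa_prior \<kappa> \<xi> = complex_of_real (r powr (- \<kappa> + 1) * d)"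
    using r d by (simp only: kappa_prior_def jeffreys_prior_polydisc[OF \<xi>] powr_of_real less_imp_le of_real_mult)
  then have "kappa_prior \<kappa> \<xi> \<in> \<real>\<^sub>\<ge>\<^sub>0"
    using d(1) by (simp add: less_imp_le)
  then show "kappa_prior \<kappa> \<xi> \<in> \<real>\<^sub>\<ge>\<^sub>0 \<and> kappa_prior \<kappa> differentiable (at \<xi>) \<and>
      (\<forall>\<beta>. wirtinger \<beta> (kappa_prior \<kappa>) \<xi> = ?L \<beta> * kappa_prior \<kappa> \<xi>)"
    using has_wirtinger_imp_differentiable[OF W] has_wirtinger_imp_wirtinger[OF W] by blast
qed

end
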